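(* Let $g$ satisfy the standing assumptions, let $\lambda>0$, and let $\{X^t\}_{t\ge0}\subset\mathbb{R}^{n\times k}$ be generated from an initialization $X^0$ by proximal gradient descent with step size $s>0$ for $F(X)=g(X)+\lambda\,\mathrm{rank}(X)$, i.e. $X^{t+1}=T_{\sqrt{2\lambda s}}(X^t-s\nabla g(X^t))$. If $s\le\min\{\frac{2\lambda}{G^2},\frac1L\}$, then for all $t\ge0$, $$\mathrm{supp}(\sigma(X^{t+1}))\subseteq\mathrm{supp}(\sigma(X^t))\quad\text{and}\quad\mathrm{rank}(X^{t+1})\le\mathrm{rank}(X^t).$$
   Context: Standing assumptions: $g:\mathbb{R}^{n\times k}\to\mathbb{R}$ is convex and differentiable; the largest singular value of its gradient is bounded, $\sigma_{\max}(\nabla g(X))\le G$ for all $X$; and $\nabla g$ is $L$-Lipschitz, $\|\nabla g(X_1)-\nabla g(X_2)\|_F\le L\|X_1-X_2\|_F$ for all $X_1,X_2$ ($G,L>0$, $\|\cdot\|_F$ the Frobenius norm). Notation: $\sigma(X)$ is the vector of the $\min(n,k)$ singular values of $X$ in non-increasing order; $\mathrm{supp}(v)$ is the set of indices of nonzero entries of a vector $v$. Superscripts denote the iteration. Singular value hard thresholding: for $\theta\ge0$ and a singular value decomposition $Q=U\Sigma V^T$, $T_\theta(Q)=U\Sigma_\theta V^T$, where $\Sigma_\theta(i,i)=0$ if $|\Sigma(i,i)|\le\theta$ and $\Sigma_\theta(i,i)=\Sigma(i,i)$ otherwise. *)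

theory Defs
  imports "HOL-Analysis.Analysis"
begin

text \<open>
  An n-by-k real matrix is an element of \<open>real^'k^'n\<close>; the library's norm and inner product on
  this type are the Frobenius norm and inner product, so \<open>GDERIV\<close> gives the matrix gradient.
\<close>

text \<open>
  The rectangular matrix with main diagonal \<open>d\<close>. Rows and columns are indexed by two unrelated
  finite types, so the main diagonal is taken with respect to the enumerations \<open>to_nat_on UNIV\<close>,
  which are bijections onto the numbers below \<open>CARD('n)\<close> and \<open>CARD('k)\<close>. Other enumerations only
  permute the columns of the orthogonal factors in a singular value decomposition.
\<close>

definition rect_diag :: "real list \<Rightarrow> real^'k^'n" where
  "rect_diag d =
    (\<chi> i j. if to_nat_on (UNIV :: 'n set) i = to_nat_on (UNIV :: 'k set) j
            then d ! to_nat_on (UNIV :: 'n set) i else 0)"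

definition is_svd :: "real^'k^'n \<Rightarrow> real^'n^'n \<Rightarrow> real list \<Rightarrow> real^'k^'k \<Rightarrow> bool" where
  "is_svd Q U d V \<longleftrightarrow>
    orthogonal_matrix U \<and> orthogonal_matrix V \<and>
    length d = min CARD('n) CARD('k) \<and> sorted_wrt (\<ge>) d \<and> (\<forall>x\<in>set d. 0 \<le> x) \<and>
    Q = U ** rect_diag d ** transpose V"

text \<open>
  Every real matrix has a singular value decomposition, and neither the list of singular values
  nor the thresholded matrix depends on which one is used; the choices below are therefore
  immaterial.
\<close>

definition singular_values :: "real^'k^'n \<Rightarrow> real list" where
  "singular_values X = (SOME d. \<exists>U V. is_svd X U d V)"

definition sigma_max :: "real^'k^'n \<Rightarrow> real" where
  "sigma_max X = Max (set (singular_values X))"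

definition supp :: "real list \<Rightarrow> nat set" where
  "supp v = {i. i < length v \<and> v ! i \<noteq> 0}"

definition sv_hard_threshold :: "real \<Rightarrow> real^'k^'n \<Rightarrow> real^'k^'n" where
  "sv_hard_threshold \<theta> Q =
    (SOME Y. \<exists>U d V. is_svd Q U d V \<and>
       Y = U ** rect_diag (map (\<lambda>x. if \<bar>x\<bar> \<le> \<theta> then 0 else x) d) ** transpose V)"

end

theory Submission imports Defs begin

text \<open>
  One step subtracts \<open>E = s *\<^sub>R grad_g (X t)\<close> from \<open>X t\<close> and then discards all singular values up to
  \<open>\<theta> = sqrt (2 * lam * s)\<close>. The operator norm of \<open>E\<close> is at most \<open>s * G\<close>, and \<open>s \<le> 2 * lam / G\<^sup>2\<close> means
  \<open>s * G \<le> \<theta>\<close>. Such a perturbation cannot create more than \<open>rank (X t)\<close> singular values above \<open>\<theta>\<close>: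
  on the span of the right singular vectors of \<open>X t - E\<close> belonging to values above \<open>\<theta>\<close>, the vector
  \<open>(X t - E) *v x\<close> is strictly longer than \<open>E *v x\<close> unless \<open>x = 0\<close>, so \<open>X t\<close> is injective on that span and its
  dimension is bounded by the rank (\<open>rank_sv_hard_threshold_perturbed_le\<close>). The number of values
  above \<open>\<theta>\<close> is the rank of the next iterate (\<open>rank_sv_hard_threshold\<close>). Since singular values are
  sorted, their support is the initial segment of length equal to the rank
  (\<open>supp_singular_values\<close>), which turns the comparison of ranks into the inclusion of supports.

  The singular values and the thresholded matrix are chosen by Hilbert's epsilon among all
  decompositions, so every property of them rests on the existence of a singular value
  decomposition (\<open>svd_exists\<close>). It is obtained by repeatedly maximising \<open>x \<bullet> (A *v y)\<close> over unit
  vectors orthogonal to the pairs already found (\<open>maximal_singular_pair\<close>).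
\<close>

section \<open>Orthonormal families\<close>

definition orthonormal_upto :: "nat \<Rightarrow> (nat \<Rightarrow> 'a::euclidean_space) \<Rightarrow> bool" where
  "orthonormal_upto m u \<longleftrightarrow> (\<forall>i<m. \<forall>j<m. u i \<bullet> u j = (if i = j then 1 else 0))"

lemma orthonormal_uptoD:
  "orthonormal_upto m u \<Longrightarrow> i < m \<Longrightarrow> j < m \<Longrightarrow> u i \<bullet> u j = (if i = j then 1 else 0)"
  by (simp add: orthonormal_upto_def)

lemma orthonormal_upto_mono:
  "orthonormal_upto m u \<Longrightarrow> k \<le> m \<Longrightarrow> orthonormal_upto k u"
  by (simp add: orthonormal_upto_def)

lemma orthonormal_upto_insert:
  assumes "orthonormal_upto m u" "norm x = 1" "\<forall>i<m. u i \<bullet> x = 0"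
  shows "orthonormal_upto (Suc m) (u(m := x))"
  using assms
  by (auto simp: orthonormal_upto_def less_Suc_eq inner_commute power2_norm_eq_inner[symmetric])

lemma exists_unit_vector_orthogonal:
  fixes u :: "nat \<Rightarrow> 'a::euclidean_space"
  assumes "m < DIM('a)"
  shows "\<exists>x. norm x = 1 \<and> (\<forall>i<m. u i \<bullet> x = 0)"
proof -
  have "dim (u ` {..<m}) \<le> card (u ` {..<m})"
    by (intro dim_le_card') auto
  also have "\<dots> \<le> m"
    using card_image_le[of "{..<m}" u] by simp
  finally have "dim (u ` {..<m}) < DIM('a)"
    using assms by simp
  then obtain x where x: "x \<noteq> 0" "\<And>y. y \<in> span (u ` {..<m}) \<Longrightarrow> orthogonal x y"
    by (rule orthogonal_to_subspace_exists) blast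
  have "u i \<bullet> x = 0" if "i < m" for i
    using x(2)[of "u i"] that by (auto simp: orthogonal_def inner_commute span_base)
  then show ?thesis
    using x(1) by (intro exI[of _ "x /\<^sub>R norm x"]) auto
qed

lemma orthonormal_upto_extend:
  fixes u :: "nat \<Rightarrow> 'a::euclidean_space"
  assumes "orthonormal_upto m u" "m \<le> k" "k \<le> DIM('a)"
  shows "\<exists>w. orthonormal_upto k w \<and> (\<forall>i<m. w i = u i)"
  using assms(2,3)
proof (induction rule: dec_induct)
  case base
  show ?case using assms(1) by blast
next
  case (step l)
  then obtain w where w: "orthonormal_upto l w" "\<forall>i<m. w i = u i"
    by auto
  obtain x where "norm x = 1" "\<forall>i<l. w i \<bullet> x = 0"
    using exists_unit_vector_orthogonal[of l w] step.prems by auto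
  then have "orthonormal_upto (Suc l) (w(l := x))"
    by (intro orthonormal_upto_insert w)
  then show ?case
    using w(2) step.hyps by (intro exI[of _ "w(l := x)"]) (simp del: fun_upd_apply, simp)
qed

lemma inj_on_orthonormal:
  assumes "orthonormal_upto m u" "I \<subseteq> {..<m}"
  shows "inj_on u I"
proof (rule inj_onI)
  fix i j assume "i \<in> I" "j \<in> I" "u i = u j"
  then show "i = j"
    using orthonormal_uptoD[OF assms(1), of i j] orthonormal_uptoD[OF assms(1), of i i] assms(2)
    by (auto simp: subset_iff split: if_splits)
qed

lemma inner_orthonormal_sum:
  assumes "orthonormal_upto m u" "I \<subseteq> {..<m}" "j < m"
  shows "u j \<bullet> (\<Sum>i\<in>I. c i *\<^sub>R u i) = (if j \<in> I then c j else 0)"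
proof -
  have "finite I"
    using assms(2) finite_subset by blast
  have "u j \<bullet> (\<Sum>i\<in>I. c i *\<^sub>R u i) = (\<Sum>i\<in>I. if i = j then c i else 0)"
    unfolding inner_sum_right
    using assms(2,3) by (intro sum.cong) (auto simp: orthonormal_uptoD[OF assms(1)] subset_iff)
  then show ?thesis
    using \<open>finite I\<close> by simp
qed

lemma norm_orthonormal_sum:
  assumes "orthonormal_upto m u" "I \<subseteq> {..<m}"
  shows "(norm (\<Sum>i\<in>I. c i *\<^sub>R u i))\<^sup>2 = (\<Sum>i\<in>I. (c i)\<^sup>2)"
proof -
  have "(norm (\<Sum>i\<in>I. c i *\<^sub>R u i))\<^sup>2 = (\<Sum>j\<in>I. c j * (u j \<bullet> (\<Sum>i\<in>I. c i *\<^sub>R u i)))"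
    by (subst power2_norm_eq_inner) (simp add: inner_sum_left)
  also have "\<dots> = (\<Sum>j\<in>I. (c j)\<^sup>2)"
    using assms(2)
    by (intro sum.cong) (auto simp: inner_orthonormal_sum[OF assms] power2_eq_square subset_iff)
  finally show ?thesis .
qed

lemma bessel_inequality:
  assumes "orthonormal_upto m u"
  shows "(\<Sum>i<m. (u i \<bullet> x)\<^sup>2) \<le> (norm x)\<^sup>2"
proof -
  let ?y = "\<Sum>i<m. (u i \<bullet> x) *\<^sub>R u i"
  have "?y \<bullet> x = (\<Sum>i<m. (u i \<bullet> x)\<^sup>2)"
    by (simp add: inner_sum_left power2_eq_square)
  moreover have "?y \<bullet> ?y = (\<Sum>i<m. (u i \<bullet> x)\<^sup>2)"
    using norm_orthonormal_sum[OF assms, of "{..<m}"] by (simp add: power2_norm_eq_inner)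
  moreover have "0 \<le> (x - ?y) \<bullet> (x - ?y)"
    by simp
  ultimately show ?thesis
    by (simp add: inner_diff_left inner_diff_right inner_commute power2_norm_eq_inner)
qed

lemma dim_orthonormal:
  assumes "orthonormal_upto m u" "I \<subseteq> {..<m}"
  shows "dim (u ` I) = card I"
proof -
  have "independent (u ` I)"
  proof (rule pairwise_orthogonal_independent)
    show "pairwise orthogonal (u ` I)"
      using assms by (auto simp: pairwise_def orthogonal_def orthonormal_upto_def subset_iff)
    show "0 \<notin> u ` I"
    proof
      assume "0 \<in> u ` I"
      then obtain i where "i \<in> I" "u i = 0" by auto
      then show False
        using orthonormal_uptoD[OF assms(1), of i i] assms(2) by auto
    qed
  qed
  then show ?thesis
    by (simp add: dim_eq_card_independent card_image[OF inj_on_orthonormal[OF assms]])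
qed

section \<open>Existence of a singular value decomposition\<close>

lemma inner_matrix_vector_mult:
  "a \<bullet> (A *v b) = (transpose A *v a) \<bullet> b" for A :: "real^'k^'n"
  by (metis dot_lmul_matrix vector_transpose_matrix transpose_transpose)

text \<open>
  The next singular pair maximises \<open>x \<bullet> (A *v y)\<close> over unit vectors orthogonal to the pairs already
  found. Because \<open>A\<close> and its transpose exchange the earlier vectors, they also map one orthogonal
  complement into the other, so at a maximum \<open>x\<close> competes with the normalised vector \<open>A *v y\<close>
  itself; this forces equality in the Cauchy-Schwarz inequality and hence \<open>A *v y = c *\<^sub>R x\<close>.
  Treating both factors symmetrically avoids a separate case for vanishing singular values.
\<close>

lemma maximal_singular_pair:
  fixes A :: "real^'k^'n" and u :: "nat \<Rightarrow> real^'n" and v :: "nat \<Rightarrow> real^'k"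
  assumes p: "p < CARD('n)" "p < CARD('k)"
    and Av: "\<forall>i<p. A *v v i = d i *\<^sub>R u i"
    and Au: "\<forall>i<p. transpose A *v u i = d i *\<^sub>R v i"
  shows "\<exists>x y c. norm x = 1 \<and> norm y = 1 \<and> (\<forall>i<p. u i \<bullet> x = 0) \<and> (\<forall>i<p. v i \<bullet> y = 0) \<and>
      0 \<le> c \<and> A *v y = c *\<^sub>R x \<and> transpose A *v x = c *\<^sub>R y \<and>
      (\<forall>x' y'. norm x' = 1 \<and> norm y' = 1 \<and> (\<forall>i<p. u i \<bullet> x' = 0) \<and> (\<forall>i<p. v i \<bullet> y' = 0)
         \<longrightarrow> x' \<bullet> (A *v y') \<le> c)"
proof -
  define SU where "SU = {x. norm x = 1 \<and> (\<forall>i<p. u i \<bullet> x = 0)}"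
  define SV where "SV = {y. norm y = 1 \<and> (\<forall>i<p. v i \<bullet> y = 0)}"
  have cpt: "compact SU" "compact SV"
  proof -
    have "SU = sphere 0 1 \<inter> (\<Inter>i<p. {x. u i \<bullet> x = 0})" "SV = sphere 0 1 \<inter> (\<Inter>i<p. {x. v i \<bullet> x = 0})"
      by (auto simp: SU_def SV_def)
    then show "compact SU" "compact SV"
      by (auto intro!: compact_Int_closed closed_INT closed_hyperplane)
  qed
  have ne: "SU \<noteq> {}" "SV \<noteq> {}"
    using exists_unit_vector_orthogonal[of p u] exists_unit_vector_orthogonal[of p v] p
    by (auto simp: SU_def SV_def)
  have "continuous_on (SU \<times> SV) (\<lambda>z. fst z \<bullet> (A *v snd z))"
    by (intro continuous_intros matrix_vector_mul_bounded_linear[THEN bounded_linear.continuous_on])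
  then obtain z where z: "z \<in> SU \<times> SV"
      and zmax: "\<forall>w\<in>SU \<times> SV. fst w \<bullet> (A *v snd w) \<le> fst z \<bullet> (A *v snd z)"
    using continuous_attains_sup[OF compact_Times[OF cpt], of "\<lambda>z. fst z \<bullet> (A *v snd z)"] ne
    by blast
  define x y c where "x = fst z" "y = snd z" "c = x \<bullet> (A *v y)"
  have x: "x \<in> SU" and y: "y \<in> SV" and mx: "\<And>x' y'. x' \<in> SU \<Longrightarrow> y' \<in> SV \<Longrightarrow> x' \<bullet> (A *v y') \<le> c"
    using z zmax by (auto simp: x_y_c_def)
  have "- x \<in> SU"
    using x by (simp add: SU_def)
  then have "- c \<le> c"
    using mx[OF _ y, of "- x"] by (simp add: x_y_c_def)
  then have c0: "0 \<le> c"
    by simp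
  \<comment> \<open>This is the equality case of Cauchy-Schwarz: \<open>le\<close> says \<open>norm w \<le> c = a \<bullet> w\<close>.\<close>
  have crit: "w = c *\<^sub>R a" if a: "norm a = 1" and ca: "a \<bullet> w = c"
    and le: "w \<noteq> 0 \<Longrightarrow> (w /\<^sub>R norm w) \<bullet> w \<le> c" for a w :: "real^'m"
  proof -
    have "norm w \<le> c"
      using le c0 by (cases "w = 0") (auto simp: power2_norm_eq_inner[symmetric] power2_eq_square mult.assoc[symmetric])
    then have "(norm w)\<^sup>2 \<le> c\<^sup>2"
      by (intro power_mono) auto
    moreover have "(norm (w - c *\<^sub>R a))\<^sup>2 = (norm w)\<^sup>2 - c\<^sup>2"
      using a ca unfolding power2_norm_eq_inner norm_eq_1
      by (simp add: inner_diff_left inner_diff_right inner_commute power2_eq_square)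
    ultimately have "(norm (w - c *\<^sub>R a))\<^sup>2 \<le> 0"
      by simp
    then show ?thesis
      by simp
  qed
  have 1: "A *v y = c *\<^sub>R x"
  proof (rule crit)
    show "norm x = 1" using x by (simp add: SU_def)
    show "x \<bullet> (A *v y) = c" by (simp add: x_y_c_def)
    assume nz: "A *v y \<noteq> 0"
    have "u i \<bullet> (A *v y) = 0" if "i < p" for i
      using that Au y by (simp add: inner_matrix_vector_mult SV_def)
    then have "(A *v y) /\<^sub>R norm (A *v y) \<in> SU"
      using nz by (simp add: SU_def)
    from mx[OF this y] show "((A *v y) /\<^sub>R norm (A *v y)) \<bullet> (A *v y) \<le> c" .
  qed
  have 2: "transpose A *v x = c *\<^sub>R y"
  proof (rule crit)
    let ?w = "transpose A *v x"
    show "norm y = 1" using y by (simp add: SV_def)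
    show "y \<bullet> ?w = c" by (simp add: x_y_c_def inner_matrix_vector_mult[of _ A] inner_commute)
    assume nz: "?w \<noteq> 0"
    have "v i \<bullet> ?w = 0" if "i < p" for i
      using that Av x inner_matrix_vector_mult[of x A "v i"] by (simp add: SU_def inner_commute)
    then have "?w /\<^sub>R norm ?w \<in> SV"
      using nz by (simp add: SV_def)
    from mx[OF x this] show "(?w /\<^sub>R norm ?w) \<bullet> ?w \<le> c"
      by (simp add: inner_matrix_vector_mult inner_commute)
  qed
  show ?thesis
    using x y c0 1 2 mx unfolding SU_def SV_def by blast
qed

text \<open>
  The last clause, which bounds \<open>A\<close> on what remains by every singular value already found, is what
  keeps the singular values in non-increasing order when the system is enlarged.
\<close>

definition singular_system ::
  "real^'k^'n \<Rightarrow> nat \<Rightarrow> (nat \<Rightarrow> real) \<Rightarrow> (nat \<Rightarrow> real^'n) \<Rightarrow> (nat \<Rightarrow> real^'k) \<Rightarrow> bool" where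
  "singular_system A p d u v \<longleftrightarrow>
    orthonormal_upto p u \<and> orthonormal_upto p v \<and>
    (\<forall>i<p. 0 \<le> d i \<and> A *v v i = d i *\<^sub>R u i \<and> transpose A *v u i = d i *\<^sub>R v i) \<and>
    (\<forall>i<p. \<forall>j<i. d i \<le> d j) \<and>
    (\<forall>i<p. \<forall>x y. norm x = 1 \<and> norm y = 1 \<and> (\<forall>j<p. u j \<bullet> x = 0) \<and> (\<forall>j<p. v j \<bullet> y = 0)
         \<longrightarrow> x \<bullet> (A *v y) \<le> d i)"

lemma singular_system_exists:
  fixes A :: "real^'k^'n"
  assumes "p \<le> min CARD('n) CARD('k)"
  shows "\<exists>d u v. singular_system A p d u v"
  using assms
proof (induction p)
  case 0
  show ?case by (simp add: singular_system_def orthonormal_upto_def)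
next
  case (Suc p)
  then obtain d u v where S: "singular_system A p d u v"
    by auto
  have p: "p < CARD('n)" "p < CARD('k)"
    using Suc.prems by auto
  have Av: "\<forall>i<p. A *v v i = d i *\<^sub>R u i" and Au: "\<forall>i<p. transpose A *v u i = d i *\<^sub>R v i"
    using S by (simp_all add: singular_system_def)
  obtain x y c where xy: "norm x = 1" "norm y = 1" "\<forall>i<p. u i \<bullet> x = 0" "\<forall>i<p. v i \<bullet> y = 0"
      "0 \<le> c" "A *v y = c *\<^sub>R x" "transpose A *v x = c *\<^sub>R y"
    and mx: "\<And>x' y'. norm x' = 1 \<and> norm y' = 1 \<and> (\<forall>i<p. u i \<bullet> x' = 0) \<and> (\<forall>i<p. v i \<bullet> y' = 0)
         \<Longrightarrow> x' \<bullet> (A *v y') \<le> c"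
    using maximal_singular_pair[OF p Av Au] by metis
  have "c \<le> d i" if "i < p" for i
  proof -
    have "x \<bullet> (A *v y) \<le> d i"
      using S xy that unfolding singular_system_def by blast
    then show ?thesis
      using xy by (simp add: norm_eq_1)
  qed
  note cd = this
  have "singular_system A (Suc p) (d(p := c)) (u(p := x)) (v(p := y))"
    unfolding singular_system_def
  proof (intro conjI)
    show "orthonormal_upto (Suc p) (u(p := x))" "orthonormal_upto (Suc p) (v(p := y))"
      using S xy by (auto intro!: orthonormal_upto_insert simp: singular_system_def)
    show "\<forall>i<Suc p. 0 \<le> (d(p := c)) i \<and> A *v (v(p := y)) i = (d(p := c)) i *\<^sub>R (u(p := x)) i \<and>
        transpose A *v (u(p := x)) i = (d(p := c)) i *\<^sub>R (v(p := y)) i"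
      using S xy by (auto simp: singular_system_def less_Suc_eq)
    show "\<forall>i<Suc p. \<forall>j<i. (d(p := c)) i \<le> (d(p := c)) j"
      using S cd by (auto simp: singular_system_def less_Suc_eq)
    show "\<forall>i<Suc p. \<forall>x' y'. norm x' = 1 \<and> norm y' = 1 \<and> (\<forall>j<Suc p. (u(p := x)) j \<bullet> x' = 0) \<and>
        (\<forall>j<Suc p. (v(p := y)) j \<bullet> y' = 0) \<longrightarrow> x' \<bullet> (A *v y') \<le> (d(p := c)) i"
    proof (intro allI impI, elim conjE)
      fix i x' y'
      assume *: "i < Suc p" "norm x' = 1" "norm y' = 1" "\<forall>j<Suc p. (u(p := x)) j \<bullet> x' = 0"
        "\<forall>j<Suc p. (v(p := y)) j \<bullet> y' = 0"
      have "x' \<bullet> (A *v y') \<le> c"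
        using * by (intro mx) (auto simp: less_Suc_eq)
      then show "x' \<bullet> (A *v y') \<le> (d(p := c)) i"
        using cd[of i] *(1) by (auto simp: less_Suc_eq)
    qed
  qed
  then show ?case
    by blast
qed

section \<open>Columns of orthogonal factors as indexed families\<close>

text \<open>
  The rectangular diagonal pairs row and column indices through \<open>to_nat_on UNIV\<close>; numbering columns
  by the inverse enumeration matches the singular value \<open>d ! i\<close> with column \<open>i\<close> of either factor.
\<close>

definition nth_column :: "real^'m^'n \<Rightarrow> nat \<Rightarrow> real^'n" where
  "nth_column M i = column (from_nat_into UNIV i) M"

lemma to_nat_on_UNIV_less: "to_nat_on (UNIV :: 'm::finite set) a < CARD('m)"
  using to_nat_on_finite[of "UNIV :: 'm set"] by (auto simp: bij_betw_def)

lemma to_nat_on_from_nat_into_UNIV: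
  "i < CARD('m) \<Longrightarrow> to_nat_on (UNIV :: 'm::finite set) (from_nat_into UNIV i) = i"
  using to_nat_on_finite[of "UNIV :: 'm set"] by (intro to_nat_on_from_nat_into) (simp add: bij_betw_def)

lemma column_eq_nth_column: "column a M = nth_column M (to_nat_on UNIV a)"
  by (simp add: nth_column_def)

lemma sum_UNIV_reindex:
  "(\<Sum>a\<in>UNIV. f (a::'m::finite)) = (\<Sum>i<CARD('m). f (from_nat_into UNIV i))"
  by (rule sum.card_from_nat_into[symmetric])

lemma transpose_mult_nth: "(transpose M ** N) $ a $ b = column a M \<bullet> column b N" for M N :: "real^_^_"
  by (simp add: matrix_matrix_mult_def transpose_def column_def inner_vec_def)

lemma orthogonal_matrix_iff_orthonormal:
  fixes U :: "real^'n^'n"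
  shows "orthogonal_matrix U \<longleftrightarrow> orthonormal_upto CARD('n) (nth_column U)"
proof -
  have "orthogonal_matrix U \<longleftrightarrow> (\<forall>a b. column a U \<bullet> column b U = (if a = b then 1 else 0))"
    by (simp add: orthogonal_matrix vec_eq_iff transpose_mult_nth mat_def)
  also have "\<dots> \<longleftrightarrow> orthonormal_upto CARD('n) (nth_column U)"
    unfolding orthonormal_upto_def
  proof (intro iffI allI impI)
    fix i j assume *: "\<forall>a b. column a U \<bullet> column b U = (if a = b then 1 else 0)" "i < CARD('n)" "j < CARD('n)"
    show "nth_column U i \<bullet> nth_column U j = (if i = j then 1 else 0)"
      unfolding nth_column_def using * to_nat_on_from_nat_into_UNIV by metis
  next
    fix a b assume *: "\<forall>i<CARD('n). \<forall>j<CARD('n). nth_column U i \<bullet> nth_column U j = (if i = j then 1 else 0)"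
    show "column a U \<bullet> column b U = (if a = b then 1 else 0)"
      unfolding column_eq_nth_column using * by (simp add: to_nat_on_UNIV_less)
  qed
  finally show ?thesis .
qed

text \<open>
  A maximal singular system exhausts the smaller of the two spaces. After completing both families
  to orthonormal bases, every entry \<open>u' i \<bullet> (A *v v' j)\<close> has an index below the minimum on one side
  or the other, and there the singular relation for \<open>A\<close> or for its transpose evaluates it.
\<close>

theorem svd_exists:
  fixes A :: "real^'k^'n"
  shows "\<exists>U d V. is_svd A U d V"
proof -
  let ?p = "min CARD('n) CARD('k)"
  obtain d u v where S: "singular_system A ?p d u v"
    using singular_system_exists[of ?p A] by auto
  obtain u' where u': "orthonormal_upto CARD('n) u'" "\<And>i. i < ?p \<Longrightarrow> u' i = u i"
    using orthonormal_upto_extend[of ?p u "CARD('n)"] S by (auto simp: singular_system_def)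
  obtain v' where v': "orthonormal_upto CARD('k) v'" "\<And>i. i < ?p \<Longrightarrow> v' i = v i"
    using orthonormal_upto_extend[of ?p v "CARD('k)"] S by (auto simp: singular_system_def)
  define U :: "real^'n^'n" where "U = (\<chi> a b. u' (to_nat_on UNIV b) $ a)"
  define V :: "real^'k^'k" where "V = (\<chi> a b. v' (to_nat_on UNIV b) $ a)"
  define ds where "ds = map d [0..<?p]"
  have colU: "column b U = u' (to_nat_on UNIV b)" for b
    by (simp add: U_def column_def vec_eq_iff)
  have colV: "column b V = v' (to_nat_on UNIV b)" for b
    by (simp add: V_def column_def vec_eq_iff)
  have nU: "nth_column U i = u' i" if "i < CARD('n)" for i
    using that by (simp add: nth_column_def colU to_nat_on_from_nat_into_UNIV)
  have nV: "nth_column V i = v' i" if "i < CARD('k)" for i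
    using that by (simp add: nth_column_def colV to_nat_on_from_nat_into_UNIV)
  have oU: "orthogonal_matrix U" and oV: "orthogonal_matrix V"
    using u'(1) v'(1) by (auto simp: orthogonal_matrix_iff_orthonormal orthonormal_upto_def nU nV)
  have entry: "u' i \<bullet> (A *v v' j) = (if i = j then d i else 0)" if ij: "i < CARD('n)" "j < CARD('k)" for i j
  proof (cases "j < ?p")
    case True
    then have "A *v v' j = d j *\<^sub>R u' j"
      using S u' v' by (simp add: singular_system_def)
    then show ?thesis
      using orthonormal_uptoD[OF u'(1), of i j] ij True by auto
  next
    case False
    then have i: "i < ?p"
      using ij by auto
    then have "transpose A *v u' i = d i *\<^sub>R v' i"
      using S u' v' by (simp add: singular_system_def)
    then show ?thesis
      using orthonormal_uptoD[OF v'(1), of i j] ij i unfolding inner_matrix_vector_mult[of _ A] by auto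
  qed
  have "transpose U ** A ** V = rect_diag ds"
  proof (intro vec_eq_iff[THEN iffD2] allI)
    fix a b
    have "(transpose U ** A ** V) $ a $ b = column a U \<bullet> (A *v column b V)"
    proof -
      have "column b (A ** V) = A *v column b V"
        by (simp add: matrix_matrix_mult_def matrix_vector_mult_def column_def)
      then show ?thesis
        by (simp add: matrix_mul_assoc[symmetric] transpose_mult_nth)
    qed
    also have "\<dots> = rect_diag ds $ a $ b"
      using to_nat_on_UNIV_less[of a] to_nat_on_UNIV_less[of b]
      by (auto simp: colU colV entry rect_diag_def ds_def)
    finally show "(transpose U ** A ** V) $ a $ b = rect_diag ds $ a $ b" .
  qed
  then have "U ** rect_diag ds ** transpose V = (U ** transpose U) ** A ** (V ** transpose V)"
    by (metis matrix_mul_assoc)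
  also have "\<dots> = A"
    using oU oV by (simp add: orthogonal_matrix_def)
  finally have "A = U ** rect_diag ds ** transpose V" ..
  moreover have "sorted_wrt (\<ge>) ds" "\<forall>x\<in>set ds. 0 \<le> x" "length ds = ?p"
    using S by (auto simp: ds_def singular_system_def sorted_wrt_iff_nth_less)
  ultimately show ?thesis
    using oU oV unfolding is_svd_def by blast
qed

section \<open>Rank and norm bounds from a decomposition\<close>

lemma svd_matrix_vector_mult:
  fixes Q :: "real^'k^'n"
  assumes "is_svd Q U d V"
  shows "Q *v x = (\<Sum>i<length d. (d ! i * (nth_column V i \<bullet> x)) *\<^sub>R nth_column U i)"
proof -
  let ?p = "min CARD('n) CARD('k)"
  have len: "length d = ?p" and Q: "Q = U ** rect_diag d ** transpose V"
    using assms by (auto simp: is_svd_def)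
  have tV: "(transpose V *v x) $ b = column b V \<bullet> x" for b
    by (simp add: matrix_vector_mult_def transpose_def column_def inner_vec_def)
  have D: "(rect_diag d *v y) $ a =
      (if to_nat_on UNIV a < ?p then d ! to_nat_on UNIV a * y $ from_nat_into UNIV (to_nat_on UNIV a) else 0)"
    for a :: 'n and y :: "real^'k"
  proof -
    let ?i = "to_nat_on UNIV a"
    have "(rect_diag d *v y) $ a = (\<Sum>j<CARD('k). if j = ?i then d ! ?i * y $ from_nat_into UNIV ?i else 0)"
      unfolding matrix_vector_mult_def rect_diag_def vec_lambda_beta sum_UNIV_reindex
      by (intro sum.cong) (auto simp: to_nat_on_from_nat_into_UNIV)
    then show ?thesis
      using to_nat_on_UNIV_less[of a] by simp
  qed
  have "Q *v x = U *v (rect_diag d *v (transpose V *v x))"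
    unfolding Q by (simp only: matrix_vector_mul_assoc matrix_mul_assoc)
  also have "\<dots> = (\<Sum>i<CARD('n). if i < ?p then (d ! i * (nth_column V i \<bullet> x)) *\<^sub>R nth_column U i else 0)"
    unfolding matrix_mult_sum[of U] sum_UNIV_reindex D tV nth_column_def
    by (intro sum.cong) (auto simp: to_nat_on_from_nat_into_UNIV scalar_mult_eq_scaleR)
  also have "\<dots> = (\<Sum>i<?p. (d ! i * (nth_column V i \<bullet> x)) *\<^sub>R nth_column U i)"
    by (rule sum.mono_neutral_cong_right) auto
  finally show ?thesis
    by (simp add: len)
qed

lemma svd_orthonormal:
  fixes Q :: "real^'k^'n"
  assumes "is_svd Q U d V"
  shows "orthonormal_upto (length d) (nth_column U)" "orthonormal_upto (length d) (nth_column V)"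
  using assms by (auto simp: is_svd_def orthogonal_matrix_iff_orthonormal intro: orthonormal_upto_mono)

text \<open>The left singular vectors with nonzero singular value form a basis of the column space.\<close>

lemma rank_eq_card_supp:
  fixes Q :: "real^'k^'n"
  assumes "is_svd Q U d V"
  shows "rank Q = card (supp d)"
proof -
  note oU = svd_orthonormal(1)[OF assms] and oV = svd_orthonormal(2)[OF assms]
  have sub: "supp d \<subseteq> {..<length d}"
    by (auto simp: supp_def)
  have "range (\<lambda>x. Q *v x) = span (nth_column U ` supp d)"
  proof (intro equalityI subsetI)
    fix y assume "y \<in> range (\<lambda>x. Q *v x)"
    then obtain x where y: "y = (\<Sum>i<length d. (d ! i * (nth_column V i \<bullet> x)) *\<^sub>R nth_column U i)"
      by (auto simp: svd_matrix_vector_mult[OF assms])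
    have "(d ! i * (nth_column V i \<bullet> x)) *\<^sub>R nth_column U i \<in> span (nth_column U ` supp d)"
      if "i < length d" for i
      using that by (cases "d ! i = 0") (auto simp: supp_def span_zero intro!: span_mul intro: span_base)
    then show "y \<in> span (nth_column U ` supp d)"
      unfolding y by (intro span_sum) auto
  next
    have "nth_column U i \<in> range (\<lambda>x. Q *v x)" if i: "i \<in> supp d" for i
    proof -
      have i': "i < length d" "d ! i \<noteq> 0"
        using i by (auto simp: supp_def)
      have "Q *v nth_column V i = (\<Sum>j<length d. if j = i then d ! i *\<^sub>R nth_column U i else 0)"
        unfolding svd_matrix_vector_mult[OF assms]
        using i' by (intro sum.cong) (auto simp: orthonormal_uptoD[OF oV])
      also have "\<dots> = d ! i *\<^sub>R nth_column U i"
        using i' by simp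
      finally have "Q *v (nth_column V i /\<^sub>R d ! i) = nth_column U i"
        using i' by (simp add: matrix_vector_mult_scaleR)
      then show ?thesis
        by (metis rangeI)
    qed
    moreover have "subspace (range (\<lambda>x. Q *v x))"
      by (intro linear_subspace_image matrix_vector_mul_linear subspace_UNIV)
    ultimately have "span (nth_column U ` supp d) \<subseteq> range (\<lambda>x. Q *v x)"
      by (intro span_minimal) auto
    then show "y \<in> range (\<lambda>x. Q *v x)" if "y \<in> span (nth_column U ` supp d)" for y
      using that by blast
  qed
  then show ?thesis
    by (simp add: rank_dim_range dim_orthonormal[OF oU sub])
qed

lemma supp_eq_lessThan_card:
  assumes "sorted_wrt (\<ge>) d" "\<forall>x\<in>set d. 0 \<le> x"
  shows "supp d = {..<card (supp d)}"
proof -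
  have down: "j \<in> supp d" if "i \<in> supp d" "j < i" for i j
  proof -
    have "d ! j \<ge> d ! i" "d ! i \<ge> 0" "d ! i \<noteq> 0" "j < length d"
      using that assms by (auto simp: supp_def sorted_wrt_iff_nth_less)
    then show ?thesis
      by (auto simp: supp_def)
  qed
  have fin: "finite (supp d)"
    by (simp add: supp_def)
  show ?thesis
  proof (cases "supp d = {}")
    case False
    have "supp d = {..Max (supp d)}"
      using down Max_in[OF fin False] Max_ge[OF fin] by (auto simp: le_less)
    then obtain m where "supp d = {..m}" by blast
    then show ?thesis
      by (simp add: lessThan_Suc_atMost)
  qed simp
qed

lemma is_svd_singular_values: "\<exists>U V. is_svd X U (singular_values X) V"
  unfolding singular_values_def using svd_exists[of X] by (intro someI_ex[of "\<lambda>d. \<exists>U V. is_svd X U d V"]) blast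

text \<open>
  Sorting pushes the zeros to the end, so the support carries no more information than the rank;
  inclusion of supports and comparison of ranks are the same thing.
\<close>

lemma supp_singular_values: "supp (singular_values X) = {..<rank X}"
proof -
  obtain U V where svd: "is_svd X U (singular_values X) V"
    using is_svd_singular_values by blast
  then have "supp (singular_values X) = {..<card (supp (singular_values X))}"
    by (intro supp_eq_lessThan_card) (auto simp: is_svd_def)
  then show ?thesis
    by (simp add: rank_eq_card_supp[OF svd])
qed

text \<open>
  By Bessel's inequality the coordinates of \<open>x\<close> along the right singular vectors have total square at
  most \<open>(norm x)\<^sup>2\<close>, and each is scaled by at most the largest singular value.
\<close>

lemma norm_mult_le_sigma_max:
  fixes A :: "real^'k^'n"
  shows "norm (A *v x) \<le> sigma_max A * norm x"
proof -
  let ?d = "singular_values A"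
  obtain U V where svd: "is_svd A U ?d V"
    using is_svd_singular_values by blast
  then have len: "length ?d = min CARD('n) CARD('k)" and nn: "\<forall>x\<in>set ?d. 0 \<le> x"
    by (auto simp: is_svd_def)
  have le: "?d ! i \<le> sigma_max A" "0 \<le> ?d ! i" if "i < length ?d" for i
    using that nn by (auto simp: sigma_max_def)
  have "0 < length ?d"
    by (simp add: len)
  then have s0: "0 \<le> sigma_max A"
    using le by (meson order_trans)
  have "(norm (A *v x))\<^sup>2 = (\<Sum>i<length ?d. (?d ! i * (nth_column V i \<bullet> x))\<^sup>2)"
    unfolding svd_matrix_vector_mult[OF svd] by (rule norm_orthonormal_sum[OF svd_orthonormal(1)[OF svd]]) simp
  also have "\<dots> \<le> (\<Sum>i<length ?d. (sigma_max A)\<^sup>2 * (nth_column V i \<bullet> x)\<^sup>2)"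
    unfolding power_mult_distrib using le by (intro sum_mono mult_right_mono power_mono) auto
  also have "\<dots> \<le> (sigma_max A)\<^sup>2 * (norm x)\<^sup>2"
    unfolding sum_distrib_left[symmetric]
    by (intro mult_left_mono bessel_inequality svd_orthonormal(2)[OF svd]) auto
  finally show ?thesis
    using s0 by (simp add: power_mult_distrib[symmetric] abs_le_square_iff[symmetric])
qed

text \<open>
  The strict inequality, which makes injectivity on the span possible, comes from the coefficient of
  \<open>x\<close> that does not vanish.
\<close>

lemma norm_mult_gt_on_large_singular_vectors:
  fixes Q :: "real^'k^'n"
  assumes svd: "is_svd Q U d V" and "0 \<le> \<theta>"
    and x: "x \<in> span (nth_column V ` {i. i < length d \<and> \<theta> < d ! i})" "x \<noteq> 0"
  shows "\<theta> * norm x < norm (Q *v x)"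
proof -
  let ?I = "{i. i < length d \<and> \<theta> < d ! i}"
  note oU = svd_orthonormal(1)[OF svd] and oV = svd_orthonormal(2)[OF svd]
  have I: "?I \<subseteq> {..<length d}" "finite ?I"
    by auto
  obtain b where b: "x = (\<Sum>w\<in>nth_column V ` ?I. b w *\<^sub>R w)"
    using x(1) unfolding span_finite[OF finite_imageI[OF I(2)]] by blast
  define c where "c = b \<circ> nth_column V"
  have c: "x = (\<Sum>i\<in>?I. c i *\<^sub>R nth_column V i)"
    unfolding b c_def by (subst sum.reindex[OF inj_on_orthonormal[OF oV I(1)]]) simp
  have "nth_column V i \<bullet> x = (if i \<in> ?I then c i else 0)" if "i < length d" for i
    unfolding c using inner_orthonormal_sum[OF oV I(1) that] .
  then have "Q *v x = (\<Sum>i<length d. if i \<in> ?I then (d ! i * c i) *\<^sub>R nth_column U i else 0)"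
    unfolding svd_matrix_vector_mult[OF svd] by (intro sum.cong) auto
  also have "\<dots> = (\<Sum>i\<in>?I. (d ! i * c i) *\<^sub>R nth_column U i)"
    by (rule sum.mono_neutral_cong_right) auto
  finally have "(norm (Q *v x))\<^sup>2 = (\<Sum>i\<in>?I. (d ! i * c i)\<^sup>2)"
    using norm_orthonormal_sum[OF oU I(1), of "\<lambda>i. d ! i * c i"] by simp
  moreover have "(\<theta> * norm x)\<^sup>2 = (\<Sum>i\<in>?I. (\<theta> * c i)\<^sup>2)"
    using norm_orthonormal_sum[OF oV I(1), of c] by (simp add: c power_mult_distrib sum_distrib_left)
  moreover have "(\<Sum>i\<in>?I. (\<theta> * c i)\<^sup>2) < (\<Sum>i\<in>?I. (d ! i * c i)\<^sup>2)"
  proof (rule sum_strict_mono_ex1[OF I(2)])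
    show "\<forall>i\<in>?I. (\<theta> * c i)\<^sup>2 \<le> (d ! i * c i)\<^sup>2"
      using \<open>0 \<le> \<theta>\<close> by (auto simp: power_mult_distrib intro!: mult_right_mono power_mono)
    have "\<exists>i\<in>?I. c i \<noteq> 0"
    proof (rule ccontr)
      assume "\<not> ?thesis"
      then have "x = 0" unfolding c by (intro sum.neutral) auto
      then show False using x(2) by simp
    qed
    then show "\<exists>i\<in>?I. (\<theta> * c i)\<^sup>2 < (d ! i * c i)\<^sup>2"
      using \<open>0 \<le> \<theta>\<close>
      by (auto simp: power_mult_distrib intro!: bexI mult_strict_right_mono power_strict_mono)
  qed
  ultimately have "(\<theta> * norm x)\<^sup>2 < (norm (Q *v x))\<^sup>2"
    by simp
  then show ?thesis
    by (rule power2_less_imp_less) simp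
qed

section \<open>Hard thresholding of a perturbed matrix\<close>

text \<open>
  Zeroing the small values leaves the list sorted and nonnegative, so the same orthogonal factors
  decompose the thresholded matrix and its rank counts the surviving values.
\<close>

lemma rank_sv_hard_threshold:
  fixes Q :: "real^'k^'n"
  assumes "0 \<le> \<theta>"
  shows "\<exists>U d V. is_svd Q U d V \<and>
    rank (sv_hard_threshold \<theta> Q) = card {i. i < length d \<and> \<theta> < d ! i}"
proof -
  let ?h = "\<lambda>x::real. if \<bar>x\<bar> \<le> \<theta> then 0 else x"
  let ?P = "\<lambda>Y. \<exists>U d V. is_svd Q U d V \<and> Y = U ** rect_diag (map ?h d) ** transpose V"
  have "\<exists>Y. ?P Y"
    using svd_exists[of Q] by blast
  then have "?P (sv_hard_threshold \<theta> Q)"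
    unfolding sv_hard_threshold_def by (rule someI_ex)
  then obtain U d V where svd: "is_svd Q U d V"
    and T: "sv_hard_threshold \<theta> Q = U ** rect_diag (map ?h d) ** transpose V"
    by blast
  have nn: "\<forall>i<length d. 0 \<le> d ! i"
    using svd by (auto simp: is_svd_def)
  have "is_svd (sv_hard_threshold \<theta> Q) U (map ?h d) V"
  proof -
    have "sorted_wrt (\<ge>) (map ?h d)"
      using svd nn unfolding is_svd_def sorted_wrt_iff_nth_less
      by (smt (verit) length_map nth_map order.strict_trans)
    then show ?thesis
      using svd T by (auto simp: is_svd_def)
  qed
  then have "rank (sv_hard_threshold \<theta> Q) = card (supp (map ?h d))"
    by (rule rank_eq_card_supp)
  also have "supp (map ?h d) = {i. i < length d \<and> \<theta> < d ! i}"
    using nn assms by (auto simp: supp_def split: if_splits)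
  finally show ?thesis
    using svd by blast
qed

lemma dim_le_rank:
  fixes A :: "real^'k^'n"
  assumes "subspace S" "\<And>x. x \<in> S \<Longrightarrow> A *v x = 0 \<Longrightarrow> x = 0"
  shows "dim S \<le> rank A"
proof -
  have "inj_on ((*v) A) (span S)"
    using assms by (simp add: linear_inj_on_iff_eq_0 span_eq_iff[THEN iffD2])
  then have "dim ((*v) A ` S) = dim S"
    by (intro dim_image_eq matrix_vector_mul_linear)
  then show ?thesis
    unfolding rank_dim_range by (metis dim_subset image_mono subset_UNIV)
qed

text \<open>
  This is the instance of Weyl's inequality for singular values that matters here: a perturbation of
  operator norm at most \<open>\<theta>\<close> cannot lift more than \<open>rank X\<close> singular values above \<open>\<theta>\<close>. On the span of
  the right singular vectors of \<open>X - E\<close> with value above \<open>\<theta>\<close>, the matrix \<open>X - E\<close> stretches by more than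
  \<open>\<theta>\<close> while \<open>E\<close> stretches by at most \<open>\<theta>\<close>, so \<open>X\<close> is injective there.
\<close>

lemma rank_sv_hard_threshold_perturbed_le:
  fixes X E :: "real^'k^'n"
  assumes "0 \<le> \<theta>" "\<And>x. norm (E *v x) \<le> \<theta> * norm x"
  shows "rank (sv_hard_threshold \<theta> (X - E)) \<le> rank X"
proof -
  obtain U d V where svd: "is_svd (X - E) U d V"
    and rk: "rank (sv_hard_threshold \<theta> (X - E)) = card {i. i < length d \<and> \<theta> < d ! i}"
    using rank_sv_hard_threshold[OF assms(1)] by blast
  let ?S = "span (nth_column V ` {i. i < length d \<and> \<theta> < d ! i})"
  have "dim ?S \<le> rank X"
  proof (rule dim_le_rank)
    fix x assume x: "x \<in> ?S" "X *v x = 0"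
    show "x = 0"
    proof (rule ccontr)
      assume "x \<noteq> 0"
      then have "\<theta> * norm x < norm ((X - E) *v x)"
        using norm_mult_gt_on_large_singular_vectors[OF svd assms(1) x(1)] by simp
      also have "\<dots> = norm (E *v x)"
        using x(2) by (simp add: matrix_vector_mult_diff_rdistrib)
      also have "\<dots> \<le> \<theta> * norm x"
        by (rule assms(2))
      finally show False
        by simp
    qed
  qed simp
  then show ?thesis
    using dim_orthonormal[OF svd_orthonormal(2)[OF svd], of "{i. i < length d \<and> \<theta> < d ! i}"] rk
    by (simp add: subset_iff)
qed


theorem lemma2p1:
  fixes g :: "real^'k^'n \<Rightarrow> real"
    and grad_g :: "real^'k^'n \<Rightarrow> real^'k^'n"
    and X :: "nat \<Rightarrow> real^'k^'n"
    and G L lam s :: real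
  assumes "convex_on UNIV g"
    and "\<And>Z. GDERIV g Z :> grad_g Z"
    and "G > 0"
    and "\<And>Z. sigma_max (grad_g Z) \<le> G"
    and "L > 0"
    and "\<And>Y Z. norm (grad_g Y - grad_g Z) \<le> L * norm (Y - Z)"
    and "lam > 0"
    and "s > 0"
    and "\<And>t. X (Suc t) = sv_hard_threshold (sqrt (2 * lam * s)) (X t - s *\<^sub>R grad_g (X t))"
    and "s \<le> min (2 * lam / G\<^sup>2) (1 / L)"
  shows "\<forall>t. supp (singular_values (X (Suc t))) \<subseteq> supp (singular_values (X t)) \<and>
             rank (X (Suc t)) \<le> rank (X t)"
proof
  fix t
  let ?\<theta> = "sqrt (2 * lam * s)"
  have "s \<le> 2 * lam / G\<^sup>2"
    using assms(10) by simp
  then have "s * G\<^sup>2 \<le> 2 * lam"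
    using \<open>G > 0\<close> by (simp add: pos_le_divide_eq)
  then have "s * (s * G\<^sup>2) \<le> s * (2 * lam)"
    using \<open>s > 0\<close> by (intro mult_left_mono) auto
  \<comment> \<open>The bound on the step size says exactly that the gradient step stays within the threshold.\<close>
  then have sG: "s * G \<le> ?\<theta>"
    by (intro real_le_rsqrt) (simp add: power_mult_distrib power2_eq_square mult_ac)
  have "norm ((s *\<^sub>R grad_g (X t)) *v x) \<le> ?\<theta> * norm x" for x
  proof -
    have "norm ((s *\<^sub>R grad_g (X t)) *v x) = s * norm (grad_g (X t) *v x)"
      using \<open>s > 0\<close> by (simp add: scaleR_matrix_vector_assoc[symmetric])
    also have "\<dots> \<le> s * (sigma_max (grad_g (X t)) * norm x)"
      using \<open>s > 0\<close> by (intro mult_left_mono norm_mult_le_sigma_max) auto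
    also have "\<dots> \<le> s * (G * norm x)"
      using \<open>s > 0\<close> assms(4) by (intro mult_left_mono mult_right_mono) auto
    also have "\<dots> \<le> ?\<theta> * norm x"
      using mult_right_mono[OF sG norm_ge_zero[of x]] by (simp add: mult.assoc)
    finally show ?thesis .
  qed
  then have "rank (X (Suc t)) \<le> rank (X t)"
    unfolding assms(9)[of t] using \<open>lam > 0\<close> \<open>s > 0\<close>
    by (intro rank_sv_hard_threshold_perturbed_le) auto
  then show "supp (singular_values (X (Suc t))) \<subseteq> supp (singular_values (X t)) \<and>
      rank (X (Suc t)) \<le> rank (X t)"
    by (simp add: supp_singular_values)
qed

end
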